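(* If $n\ge43$ and $e\in\mathbb{R}^n$ with $e\neq0$, then $\mathcal{H}^{\mathrm{SOS}}_{n,3}(e)\subsetneq\mathcal{H}_{n,3}(e)$; that is, there is a cubic form in $n$ variables that is hyperbolic, but not SOS-hyperbolic, with respect to $e$.
   Context: A homogeneous polynomial $p\in\mathbb{R}[x_1,\ldots,x_n]$ of degree $d$ is hyperbolic with respect to $e\in\mathbb{R}^n$ if $p(e)>0$ and for every $x\in\mathbb{R}^n$ the polynomial $t\mapsto p(x+te)$ has only real zeros; $\mathcal{H}_{n,d}(e)$ is the set of such polynomials. The hyperbolicity cone $\Lambda_+(p,e)$ is the set of $x\in\mathbb{R}^n$ such that all zeros of $t\mapsto p(te-x)$ are nonnegative. For $x,u\in\mathbb{R}^n$ put $p_x(t)=p(x+te)$ and $D_up_x(t)=(D_up)(x+te)$, with $D_u$ the directional derivative. The parameterized Bézoutian $B_{p,e}(x)[u]$ is the $d\times d$ symmetric matrix (with entries polynomial in $x$) defined by $$\frac{p_x(t)\,D_up_x(s)-D_up_x(t)\,p_x(s)}{t-s}=\sum_{i,j=1}^d [B_{p,e}(x)[u]]_{ij}\,t^{i-1}s^{j-1}.$$ A symmetric matrix $P(x)$ with polynomial entries is a matrix sum of squares if $P(x)=Q(x)Q(x)^T$ for some (possibly rectangular) matrix $Q$ with real polynomial entries. $p\in\mathcal{H}_{n,d}(e)$ is SOS-hyperbolic with respect to $e$ if $B_{p,e}(x)[u]$ is a matrix sum of squares for every $u\in\Lambda_+(p,e)$; $\mathcal{H}^{\mathrm{SOS}}_{n,d}(e)$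 is the set of such polynomials. *)

theory Defs
  imports
    "Jordan_Normal_Form.Matrix"
    "HOL-Analysis.Analysis"
    "HOL-Library.Poly_Mapping"
begin

no_notation vec_index (infixl \<open>$\<close> 100)
no_notation scalar_prod (infix \<open>\<bullet>\<close> 70)

section \<open>Polynomials in finitely many variables\<close>

text \<open>The polynomial ring with real coefficients and one variable for each element of the finite
  type \<open>'n\<close>, as the monoid algebra of the exponent vectors; ring operations are those of
  \<open>Poly_Mapping\<close>.\<close>

type_synonym 'n mpoly = "('n \<Rightarrow>\<^sub>0 nat) \<Rightarrow>\<^sub>0 real"

text \<open>Values are taken in a real algebra so that polynomials can be evaluated at real and at
  complex points.\<close>

definition mpoly_eval :: "'n::finite mpoly \<Rightarrow> ('a::{real_algebra_1,comm_ring_1})^'n \<Rightarrow> 'a" where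
  "mpoly_eval p x = (\<Sum>m\<in>Poly_Mapping.keys p.
     Poly_Mapping.lookup p m *\<^sub>R (\<Prod>i\<in>UNIV. (x $ i) ^ Poly_Mapping.lookup m i))"

definition homogeneous :: "nat \<Rightarrow> 'n::finite mpoly \<Rightarrow> bool" where
  "homogeneous d p \<longleftrightarrow>
     (\<forall>m\<in>Poly_Mapping.keys p. (\<Sum>i\<in>UNIV. Poly_Mapping.lookup m i) = d)"

definition partial_deriv :: "'n \<Rightarrow> 'n::finite mpoly \<Rightarrow> 'n mpoly" where
  "partial_deriv i p = (\<Sum>m\<in>Poly_Mapping.keys p.
     Poly_Mapping.single (m - Poly_Mapping.single i 1)
       (of_nat (Poly_Mapping.lookup m i) * Poly_Mapping.lookup p m))"

definition dir_deriv :: "real^'n \<Rightarrow> 'n::finite mpoly \<Rightarrow> 'n mpoly" where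
  "dir_deriv u p = (\<Sum>i\<in>UNIV. Poly_Mapping.single 0 (u $ i) * partial_deriv i p)"

section \<open>Hyperbolic polynomials\<close>

definition hyperbolic_polys :: "nat \<Rightarrow> real^'n \<Rightarrow> 'n::finite mpoly set" where
  "hyperbolic_polys d e = {p. homogeneous d p \<and> mpoly_eval p e > 0 \<and>
     (\<forall>x::real^'n. \<forall>t::complex.
        mpoly_eval p (\<chi> i. of_real (x $ i) + t * of_real (e $ i)) = 0 \<longrightarrow> t \<in> \<real>)}"

text \<open>Used only for hyperbolic \<open>p\<close>, where all complex zeros of \<open>t \<mapsto> p (t e - x)\<close> are real.\<close>

definition hyperbolicity_cone :: "'n::finite mpoly \<Rightarrow> real^'n \<Rightarrow> (real^'n) set" where
  "hyperbolicity_cone p e = {x. \<forall>t::real. mpoly_eval p (t *\<^sub>R e - x) = 0 \<longrightarrow> t \<ge> 0}"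

section \<open>The parameterized Bezoutian\<close>

text \<open>Matrix indices start at 0, so entry \<open>(i, j)\<close> is the coefficient of \<open>t ^ i * s ^ j\<close>. Over the
  reals the defining identity of polynomials in \<open>x, t, s\<close> is equivalent to the identity of values
  off the diagonal \<open>t = s\<close>. The matrix exists and is unique for homogeneous \<open>p\<close>: see
  \<open>ex1_bezoutian\<close> below.\<close>

definition is_bezoutian ::
  "nat \<Rightarrow> 'n::finite mpoly \<Rightarrow> real^'n \<Rightarrow> real^'n \<Rightarrow> 'n mpoly mat \<Rightarrow> bool" where
  "is_bezoutian d p e u B \<longleftrightarrow> B \<in> carrier_mat d d \<and>
     (\<forall>(x::real^'n) (t::real) (s::real). t \<noteq> s \<longrightarrow>
        (mpoly_eval p (x + t *\<^sub>R e) * mpoly_eval (dir_deriv u p) (x + s *\<^sub>R e)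
           - mpoly_eval (dir_deriv u p) (x + t *\<^sub>R e) * mpoly_eval p (x + s *\<^sub>R e)) / (t - s)
        = (\<Sum>i<d. \<Sum>j<d. mpoly_eval (B $$ (i, j)) x * t ^ i * s ^ j))"

definition bezoutian ::
  "nat \<Rightarrow> 'n::finite mpoly \<Rightarrow> real^'n \<Rightarrow> real^'n \<Rightarrow> 'n mpoly mat" where
  "bezoutian d p e u = (THE B. is_bezoutian d p e u B)"

section \<open>SOS-hyperbolic polynomials\<close>

definition matrix_sos :: "'n::finite mpoly mat \<Rightarrow> bool" where
  "matrix_sos P \<longleftrightarrow> (\<exists>k. \<exists>Q\<in>carrier_mat (dim_row P) k. P = Q * transpose_mat Q)"

definition sos_hyperbolic_polys :: "nat \<Rightarrow> real^'n \<Rightarrow> 'n::finite mpoly set" where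
  "sos_hyperbolic_polys d e =
     {p \<in> hyperbolic_polys d e. \<forall>u\<in>hyperbolicity_cone p e. matrix_sos (bezoutian d p e u)}"

section \<open>Existence and uniqueness of the Bezoutian\<close>

lemma mpoly_eval_superset:
  assumes "finite S" "Poly_Mapping.keys p \<subseteq> S"
  shows "mpoly_eval p x = (\<Sum>m\<in>S.
     Poly_Mapping.lookup p m *\<^sub>R (\<Prod>i\<in>UNIV. (x $ i) ^ Poly_Mapping.lookup m i))"
  unfolding mpoly_eval_def
  by (rule sum.mono_neutral_left[OF assms]) (simp add: in_keys_iff)

lemma mpoly_eval_single [simp]:
  "mpoly_eval (Poly_Mapping.single m c) x = c *\<^sub>R (\<Prod>i\<in>UNIV. (x $ i) ^ Poly_Mapping.lookup m i)"
  by (subst mpoly_eval_superset[of "{m}"]) auto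

lemma mpoly_eval_0 [simp]: "mpoly_eval 0 x = 0"
  by (simp add: mpoly_eval_def)

lemma mpoly_eval_add [simp]: "mpoly_eval (p + q) x = mpoly_eval p x + mpoly_eval q x"
proof -
  let ?S = "Poly_Mapping.keys p \<union> Poly_Mapping.keys q"
  show ?thesis
    using keys_add[of p q]
    by (subst (1 2 3) mpoly_eval_superset[of ?S])
       (auto simp: lookup_add scaleR_add_left sum.distrib)
qed

lemma mpoly_eval_uminus [simp]: "mpoly_eval (- p) x = - mpoly_eval p x"
  using mpoly_eval_add[of p "- p" x] by (simp add: eq_neg_iff_add_eq_0 add.commute)

lemma mpoly_eval_diff [simp]: "mpoly_eval (p - q) x = mpoly_eval p x - mpoly_eval q x"
  using mpoly_eval_add[of p "- q" x] by simp

lemma mpoly_eval_sum [simp]: "mpoly_eval (sum f A) x = (\<Sum>a\<in>A. mpoly_eval (f a) x)"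
  by (induction A rule: infinite_finite_induct) auto

lemma mpoly_sum_single:
  "(\<Sum>m\<in>Poly_Mapping.keys p. Poly_Mapping.single m (Poly_Mapping.lookup p m)) = p"
  by (rule poly_mapping_eqI)
     (auto simp: lookup_sum lookup_single when_def in_keys_iff sum.delta')

lemma mpoly_eval_mult [simp]: "mpoly_eval (p * q) x = mpoly_eval p x * mpoly_eval q x"
proof -
  have s: "mpoly_eval (Poly_Mapping.single m a * Poly_Mapping.single n b) x
      = mpoly_eval (Poly_Mapping.single m a) x * mpoly_eval (Poly_Mapping.single n b) x" for m n a b
    by (simp add: mult_single lookup_add power_add prod.distrib)
  let ?f = "\<lambda>p m. Poly_Mapping.single m (Poly_Mapping.lookup p m)"
  have "mpoly_eval ((\<Sum>m\<in>Poly_Mapping.keys p. ?f p m) * (\<Sum>m\<in>Poly_Mapping.keys q. ?f q m)) x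
    = mpoly_eval (\<Sum>m\<in>Poly_Mapping.keys p. ?f p m) x * mpoly_eval (\<Sum>m\<in>Poly_Mapping.keys q. ?f q m) x"
    by (simp only: sum_product mpoly_eval_sum s)
  then show ?thesis by (simp only: mpoly_sum_single)
qed

lemma mpoly_eval_1 [simp]: "mpoly_eval 1 x = 1"
  by (simp add: single_one[symmetric] del: single_one)

lemma poly_fun_0_coeff:
  fixes c :: "nat \<Rightarrow> real"
  assumes "infinite T" "\<And>t. t \<in> T \<Longrightarrow> (\<Sum>k\<le>n. c k * t ^ k) = 0" "k \<le> n"
  shows "c k = 0"
proof (rule ccontr)
  assume "c k \<noteq> 0"
  then have "finite {t. (\<Sum>k\<le>n. c k * t ^ k) = 0}"
    unfolding polyfun_finite_roots using assms(3) by blast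
  then have "finite T" by (rule finite_subset[rotated]) (use assms(2) in auto)
  then show False using assms(1) by contradiction
qed

lemma monomials_indep:
  fixes c :: "('n::finite \<Rightarrow>\<^sub>0 nat) \<Rightarrow> real"
  assumes "finite S" "finite M" "inj_on (\<lambda>m. restrict (Poly_Mapping.lookup m) S) M"
    "\<And>x::'n \<Rightarrow> real. (\<Sum>m\<in>M. c m * (\<Prod>i\<in>S. x i ^ Poly_Mapping.lookup m i)) = 0" "m \<in> M"
  shows "c m = 0"
  using assms
proof (induction S arbitrary: M rule: finite_induct)
  case empty
  have "m' = m" if "m' \<in> M" for m'
    by (rule inj_onD[OF empty.prems(2) _ that empty.prems(4)]) simp
  then have "M = {m}" using empty.prems(4) by blast
  then have "(\<Sum>m'\<in>M. c m' * (\<Prod>i\<in>{}. 0 ^ Poly_Mapping.lookup m' i)) = c m" by simp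
  then show ?case using empty.prems(3)[of "\<lambda>_. 0"] by (rule trans[OF sym])
next
  case (insert i S)
  let ?M = "{m'\<in>M. Poly_Mapping.lookup m' i = Poly_Mapping.lookup m i}"
  show ?case
  proof (rule insert.IH[of ?M])
    show "finite ?M" "m \<in> ?M" using insert.prems(1,4) by simp_all
    show "inj_on (\<lambda>m. restrict (Poly_Mapping.lookup m) S) ?M"
    proof (rule inj_onI)
      fix a b assume ab: "a \<in> ?M" "b \<in> ?M"
        "restrict (Poly_Mapping.lookup a) S = restrict (Poly_Mapping.lookup b) S"
      have "restrict (Poly_Mapping.lookup a) (insert i S) = restrict (Poly_Mapping.lookup b) (insert i S)"
      proof
        fix j show "restrict (Poly_Mapping.lookup a) (insert i S) j = restrict (Poly_Mapping.lookup b) (insert i S) j"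
          using ab(1,2) fun_cong[OF ab(3), of j] by (cases "j = i") (simp_all add: restrict_def)
      qed
      moreover have "a \<in> M" "b \<in> M" using ab(1,2) by simp_all
      ultimately show "a = b" by (rule inj_onD[OF insert.prems(2)])
    qed
    fix x :: "'n \<Rightarrow> real"
    let ?g = "\<lambda>m. c m * (\<Prod>j\<in>S. x j ^ Poly_Mapping.lookup m j)"
    let ?c = "\<lambda>k. \<Sum>m\<in>{m\<in>M. Poly_Mapping.lookup m i = k}. ?g m"
    obtain n where "\<forall>k\<in>(\<lambda>m. Poly_Mapping.lookup m i) ` M. k \<le> n"
      using finite_nat_set_iff_bounded_le[of "(\<lambda>m. Poly_Mapping.lookup m i) ` M"] insert.prems(1)
      by blast
    then have le: "Poly_Mapping.lookup m' i \<le> n" if "m' \<in> M" for m'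
      using that by blast
    have 0: "(\<Sum>k\<le>n. ?c k * t ^ k) = 0" for t
    proof -
      have "(\<Sum>k\<le>n. ?c k * t ^ k)
        = (\<Sum>k\<le>n. \<Sum>m\<in>{m\<in>M. Poly_Mapping.lookup m i = k}. ?g m * t ^ Poly_Mapping.lookup m i)"
        unfolding sum_distrib_right by (intro sum.cong refl) simp
      also have "\<dots> = (\<Sum>m\<in>M. ?g m * t ^ Poly_Mapping.lookup m i)"
        by (rule sum.group) (use insert.prems(1) le in \<open>simp_all add: image_subset_iff\<close>)
      also have "\<dots> = (\<Sum>m\<in>M. c m * (\<Prod>j\<in>insert i S. (x(i:=t)) j ^ Poly_Mapping.lookup m j))"
      proof (intro sum.cong refl)
        fix m'
        have "(\<Prod>j\<in>S. (x(i:=t)) j ^ Poly_Mapping.lookup m' j) = (\<Prod>j\<in>S. x j ^ Poly_Mapping.lookup m' j)"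
          using insert.hyps by (intro prod.cong) auto
        then show "?g m' * t ^ Poly_Mapping.lookup m' i
          = c m' * (\<Prod>j\<in>insert i S. (x(i:=t)) j ^ Poly_Mapping.lookup m' j)"
          using insert.hyps by simp
      qed
      also have "\<dots> = 0" by (rule insert.prems(3))
      finally show ?thesis .
    qed
    show "(\<Sum>m\<in>?M. ?g m) = 0"
    proof (rule poly_fun_0_coeff[of UNIV ?c n "Poly_Mapping.lookup m i"])
      show "infinite (UNIV :: real set)" by (rule infinite_UNIV_char_0)
      show "Poly_Mapping.lookup m i \<le> n" by (rule le[OF insert.prems(4)])
    qed (rule 0)
  qed
qed

lemma mpoly_eqI:
  fixes p q :: "'n::finite mpoly"
  assumes "\<And>x::real^'n. mpoly_eval p x = mpoly_eval q x"
  shows "p = q"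
proof -
  have 0: "mpoly_eval (p - q) (x::real^'n) = 0" for x
    unfolding mpoly_eval_diff assms by simp
  have eval: "(\<Sum>m\<in>Poly_Mapping.keys (p - q). Poly_Mapping.lookup (p - q) m *
      (\<Prod>i\<in>UNIV. x i ^ Poly_Mapping.lookup m i)) = mpoly_eval (p - q) (\<chi> i. x i)" for x
    by (simp only: mpoly_eval_def vec_lambda_beta real_scaleR_def)
  have lookup: "Poly_Mapping.lookup (p - q) m = 0" for m
  proof (cases "m \<in> Poly_Mapping.keys (p - q)")
    case True
    show ?thesis
    proof (rule monomials_indep[where S = UNIV and M = "Poly_Mapping.keys (p - q)"
          and c = "Poly_Mapping.lookup (p - q)"])
      show "inj_on (\<lambda>m. restrict (Poly_Mapping.lookup m) UNIV) (Poly_Mapping.keys (p - q))"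
        by (intro inj_onI poly_mapping_eqI) (drule fun_cong, simp)
      fix x :: "'n \<Rightarrow> real"
      show "(\<Sum>m\<in>Poly_Mapping.keys (p - q). Poly_Mapping.lookup (p - q) m *
          (\<Prod>i\<in>UNIV. x i ^ Poly_Mapping.lookup m i)) = 0"
        unfolding eval by (rule 0)
    qed (rule finite finite_keys True)+
  next
    case False
    then show ?thesis by (simp only: not_in_keys_iff_lookup_eq_zero)
  qed
  have "p - q = 0" by (rule poly_mapping_eqI) (simp only: lookup lookup_zero)
  then show ?thesis by simp
qed

lemma bezoutian_unique:
  assumes "is_bezoutian d p e u A" "is_bezoutian d p e u B"
  shows "A = B"
proof (rule eq_matI)
  have c: "A \<in> carrier_mat d d" "B \<in> carrier_mat d d"
    using assms[unfolded is_bezoutian_def, THEN conjunct1] by this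
  then show "dim_row A = dim_row B" "dim_col A = dim_col B" by auto
  fix i j assume ij: "i < dim_row B" "j < dim_col B"
  then have ij: "i < d" "j < d" using c by simp_all
  then obtain n where n: "d = Suc n" using gr0_conv_Suc[of d] by auto
  show "A $$ (i, j) = B $$ (i, j)"
  proof (rule mpoly_eqI)
    fix x :: "real^'a"
    let ?D = "\<lambda>i j. mpoly_eval (A $$ (i, j)) x - mpoly_eval (B $$ (i, j)) x"
    have *: "(\<Sum>i\<le>n. \<Sum>j\<le>n. ?D i j * t ^ i * s ^ j) = 0" if ts: "t \<noteq> s" for t s
    proof -
      have "(\<Sum>i<d. \<Sum>j<d. mpoly_eval (A $$ (i, j)) x * t ^ i * s ^ j)
          = (\<Sum>i<d. \<Sum>j<d. mpoly_eval (B $$ (i, j)) x * t ^ i * s ^ j)"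
        using assms[unfolded is_bezoutian_def, THEN conjunct2, rule_format, OF ts, of x]
        by (rule trans[OF sym])
      then show ?thesis
        unfolding n lessThan_Suc_atMost left_diff_distrib sum_subtractf by simp
    qed
    have 0: "(\<Sum>i\<le>n. ?D i j * t ^ i) = 0" for t
    proof (rule poly_fun_0_coeff[of "UNIV - {t}" "\<lambda>j. \<Sum>i\<le>n. ?D i j * t ^ i" n j])
      show "infinite (UNIV - {t})" by (simp add: infinite_UNIV_char_0)
      show "j \<le> n" using ij n by simp
      fix s assume "s \<in> UNIV - {t}"
      then have "(\<Sum>i\<le>n. \<Sum>j\<le>n. ?D i j * t ^ i * s ^ j) = 0" by (intro *) blast
      then show "(\<Sum>j\<le>n. (\<Sum>i\<le>n. ?D i j * t ^ i) * s ^ j) = 0"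
        unfolding sum_distrib_right by (subst sum.swap)
    qed
    have "?D i j = 0"
    proof (rule poly_fun_0_coeff[of UNIV "\<lambda>i. ?D i j" n i])
      show "infinite (UNIV :: real set)" by (rule infinite_UNIV_char_0)
      show "i \<le> n" using ij n by simp
    qed (rule 0)
    then show "mpoly_eval (A $$ (i, j)) x = mpoly_eval (B $$ (i, j)) x" by simp
  qed
qed

text \<open>\<open>f (x + t e)\<close> is a polynomial in \<open>x, t\<close> of degree less than \<open>d\<close> in \<open>t\<close>.\<close>

definition line_poly :: "nat \<Rightarrow> real^'n \<Rightarrow> (real^'n \<Rightarrow> real) \<Rightarrow> bool" where
  "line_poly d e f \<longleftrightarrow> (\<exists>c::nat \<Rightarrow> 'n::finite mpoly. \<forall>x t.
     f (x + t *\<^sub>R e) = (\<Sum>k<d. mpoly_eval (c k) x * t ^ k))"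

lemma line_poly_sum:
  assumes "finite A" "\<And>a. a \<in> A \<Longrightarrow> line_poly d e (f a)"
  shows "line_poly d e (\<lambda>x. \<Sum>a\<in>A. f a x)"
proof -
  obtain c where "\<And>a x t. a \<in> A \<Longrightarrow> f a (x + t *\<^sub>R e) = (\<Sum>k<d. mpoly_eval (c a k) x * t ^ k)"
    using assms(2) unfolding line_poly_def by metis
  then show ?thesis unfolding line_poly_def
    by (intro exI[of _ "\<lambda>k. \<Sum>a\<in>A. c a k"])
       (auto simp: sum_distrib_right intro: sum.swap)
qed

lemma line_poly_smult: "line_poly d e f \<Longrightarrow> line_poly d e (\<lambda>x. a * f x)"
  unfolding line_poly_def
  by (elim exE, rule_tac x = "\<lambda>k. Poly_Mapping.single 0 a * c k" in exI)
     (simp add: sum_distrib_left mult.assoc)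

lemma prod_single_var [simp]:
  "(\<Prod>j\<in>UNIV. (x $ j) ^ Poly_Mapping.lookup (Poly_Mapping.single i (Suc 0)) j) = (x::real^'n::finite) $ i"
proof -
  have "(x $ j) ^ Poly_Mapping.lookup (Poly_Mapping.single i (Suc 0)) j = (if j = i then x $ i else 1)" for j
    by (auto simp: lookup_single when_def)
  then show ?thesis by simp
qed

lemma line_poly_mult_var:
  assumes "line_poly d e f"
  shows "line_poly (Suc d) e (\<lambda>x. x $ i * f x)"
proof -
  obtain c where c: "\<And>x t. f (x + t *\<^sub>R e) = (\<Sum>k<d. mpoly_eval (c k) x * t ^ k)"
    using assms unfolding line_poly_def by metis
  let ?X = "Poly_Mapping.single (Poly_Mapping.single i (Suc 0)) 1 :: 'a mpoly"
  let ?c = "\<lambda>k. (if k < d then ?X * c k else 0)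
      + (if k = 0 then 0 else Poly_Mapping.single 0 (e $ i) * c (k - 1))"
  have "(x + t *\<^sub>R e) $ i * f (x + t *\<^sub>R e) = (\<Sum>k<Suc d. mpoly_eval (?c k) x * t ^ k)" for x t
  proof -
    have 1: "(\<Sum>k<Suc d. mpoly_eval (if k < d then ?X * c k else 0) x * t ^ k)
        = x $ i * f (x + t *\<^sub>R e)"
      by (simp add: c sum_distrib_left mult.assoc)
    have 2: "(\<Sum>k<Suc d. mpoly_eval (if k = 0 then 0 else Poly_Mapping.single 0 (e $ i) * c (k - 1)) x * t ^ k)
        = t * e $ i * f (x + t *\<^sub>R e)"
      by (subst sum.lessThan_Suc_shift) (simp add: c sum_distrib_left mult_ac)
    have "(\<Sum>k<Suc d. mpoly_eval (?c k) x * t ^ k) = x $ i * f (x + t *\<^sub>R e) + t * e $ i * f (x + t *\<^sub>R e)"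
      unfolding 1[symmetric] 2[symmetric] by (simp only: mpoly_eval_add distrib_right sum.distrib)
    then show ?thesis by (simp add: distrib_right)
  qed
  then show ?thesis unfolding line_poly_def by (intro exI[of _ ?c]) blast
qed

lemma line_poly_one: "line_poly (Suc 0) e (\<lambda>_. 1)"
  unfolding line_poly_def by (intro exI[of _ "\<lambda>_. 1"]) simp

lemma line_poly_monomial:
  fixes e :: "real^'n::finite"
  assumes "finite S"
  shows "line_poly (Suc (\<Sum>i\<in>S. m i)) e (\<lambda>x. \<Prod>i\<in>S. (x $ i) ^ m i)"
  using assms
proof (induction S rule: finite_induct)
  case empty then show ?case by (simp add: line_poly_one)
next
  case (insert i S)
  have "line_poly (Suc (k + (\<Sum>i\<in>S. m i))) e (\<lambda>x. (x $ i) ^ k * (\<Prod>i\<in>S. (x $ i) ^ m i))" for k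
  proof (induction k)
    case (Suc k) then show ?case using line_poly_mult_var[OF Suc, of i] by (simp add: mult.assoc)
  qed (use insert in simp)
  then show ?case using insert by simp
qed

lemma line_poly_homogeneous:
  assumes "homogeneous d p" shows "line_poly (Suc d) e (mpoly_eval p)"
proof -
  have "line_poly (Suc d) e (\<lambda>x. Poly_Mapping.lookup p m * (\<Prod>i\<in>UNIV. (x $ i) ^ Poly_Mapping.lookup m i))"
    if "m \<in> Poly_Mapping.keys p" for m
    using line_poly_smult[OF line_poly_monomial[of UNIV "Poly_Mapping.lookup m" e]] assms that
    by (simp add: homogeneous_def)
  then have "line_poly (Suc d) e (\<lambda>x. \<Sum>m\<in>Poly_Mapping.keys p. Poly_Mapping.lookup p m *
      (\<Prod>i\<in>UNIV. (x $ i) ^ Poly_Mapping.lookup m i))"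
    by (intro line_poly_sum) auto
  moreover have "mpoly_eval p = (\<lambda>x. \<Sum>m\<in>Poly_Mapping.keys p. Poly_Mapping.lookup p m *
      (\<Prod>i\<in>UNIV. (x $ i) ^ Poly_Mapping.lookup m i))"
    by (simp add: fun_eq_iff mpoly_eval_def)
  ultimately show ?thesis by simp
qed

lemma line_poly_0: "line_poly d e (\<lambda>_. 0)"
  unfolding line_poly_def by (intro exI[of _ "\<lambda>_. 0"]) simp

lemma line_poly_dir_deriv:
  fixes p :: "'n::finite mpoly"
  assumes "homogeneous d p" shows "line_poly d e (mpoly_eval (dir_deriv u p))"
proof -
  have "line_poly d e (\<lambda>x. (of_nat (Poly_Mapping.lookup m i) * Poly_Mapping.lookup p m) *
      (\<Prod>j\<in>UNIV. (x $ j) ^ Poly_Mapping.lookup (m - Poly_Mapping.single i 1) j))"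
    if m: "m \<in> Poly_Mapping.keys p" for m i
  proof (cases "Poly_Mapping.lookup m i = 0")
    case False
    have "(\<Sum>j\<in>UNIV. Poly_Mapping.lookup m j)
      = (\<Sum>j\<in>UNIV. Poly_Mapping.lookup (m - Poly_Mapping.single i 1) j + (if j = i then 1 else 0))"
      using False by (intro sum.cong) (auto simp: lookup_minus lookup_single when_def)
    then have "Suc (\<Sum>j\<in>UNIV. Poly_Mapping.lookup (m - Poly_Mapping.single i 1) j) = d"
      using assms m by (simp add: homogeneous_def sum.distrib)
    then show ?thesis
      using line_poly_smult[OF line_poly_monomial[of UNIV "Poly_Mapping.lookup (m - Poly_Mapping.single i 1)" e]]
      by simp
  qed (simp add: line_poly_0)
  then have "line_poly d e (\<lambda>x. \<Sum>m\<in>Poly_Mapping.keys p.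
      (of_nat (Poly_Mapping.lookup m i) * Poly_Mapping.lookup p m) *
      (\<Prod>j\<in>UNIV. (x $ j) ^ Poly_Mapping.lookup (m - Poly_Mapping.single i 1) j))" for i
    by (intro line_poly_sum) auto
  moreover have "mpoly_eval (partial_deriv i p) = (\<lambda>x::real^'n. \<Sum>m\<in>Poly_Mapping.keys p.
      (of_nat (Poly_Mapping.lookup m i) * Poly_Mapping.lookup p m) *
      (\<Prod>j\<in>UNIV. (x $ j) ^ Poly_Mapping.lookup (m - Poly_Mapping.single i 1) j))" for i
    by (simp add: fun_eq_iff partial_deriv_def)
  ultimately have *: "line_poly d e (mpoly_eval (partial_deriv i p))" for i by simp
  have "line_poly d e (\<lambda>x. \<Sum>i\<in>UNIV. u $ i * mpoly_eval (partial_deriv i p) x)"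
    by (intro line_poly_sum line_poly_smult) (use * in auto)
  moreover have "mpoly_eval (dir_deriv u p)
      = (\<lambda>x::real^'n. \<Sum>i\<in>UNIV. u $ i * mpoly_eval (partial_deriv i p) x)"
    by (simp add: fun_eq_iff dir_deriv_def)
  ultimately show ?thesis by simp
qed

text \<open>\<open>f x t s\<close> agrees off the diagonal \<open>t = s\<close> with a polynomial in \<open>x, t, s\<close> of degree less than \<open>d\<close>
  in each of \<open>t\<close> and \<open>s\<close>.\<close>

definition bi_poly :: "nat \<Rightarrow> (real^'n \<Rightarrow> real \<Rightarrow> real \<Rightarrow> real) \<Rightarrow> bool" where
  "bi_poly d f \<longleftrightarrow> (\<exists>c::nat \<Rightarrow> nat \<Rightarrow> 'n::finite mpoly. \<forall>x t s. t \<noteq> s \<longrightarrow>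
     f x t s = (\<Sum>i<d. \<Sum>j<d. mpoly_eval (c i j) x * t ^ i * s ^ j))"

lemma bi_poly_sum:
  assumes "finite A" "\<And>a. a \<in> A \<Longrightarrow> bi_poly d (f a)"
  shows "bi_poly d (\<lambda>x t s. \<Sum>a\<in>A. f a x t s)"
proof -
  have "\<forall>a\<in>A. \<exists>c. \<forall>x t s. t \<noteq> s \<longrightarrow>
      f a x t s = (\<Sum>i<d. \<Sum>j<d. mpoly_eval (c i j) x * t ^ i * s ^ j)"
    using assms(2) unfolding bi_poly_def by (intro ballI)
  from bchoice[OF this] obtain c where "\<forall>a\<in>A. \<forall>x t s. t \<noteq> s \<longrightarrow>
      f a x t s = (\<Sum>i<d. \<Sum>j<d. mpoly_eval (c a i j) x * t ^ i * s ^ j)" ..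
  note c = this[rule_format]
  have "(\<Sum>a\<in>A. f a x t s) = (\<Sum>i<d. \<Sum>j<d. mpoly_eval (\<Sum>a\<in>A. c a i j) x * t ^ i * s ^ j)"
    if "t \<noteq> s" for x t s
  proof -
    have "(\<Sum>a\<in>A. f a x t s) = (\<Sum>a\<in>A. \<Sum>i<d. \<Sum>j<d. mpoly_eval (c a i j) x * t ^ i * s ^ j)"
      by (intro sum.cong refl c that)
    also have "\<dots> = (\<Sum>i<d. \<Sum>j<d. \<Sum>a\<in>A. mpoly_eval (c a i j) x * t ^ i * s ^ j)"
      by (subst sum.swap) (rule sum.cong[OF refl], rule sum.swap)
    finally show ?thesis by (simp add: sum_distrib_right)
  qed
  then show ?thesis unfolding bi_poly_def
    by (intro exI[of _ "\<lambda>i j. \<Sum>a\<in>A. c a i j"] allI impI)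
qed

lemma bi_poly_mult:
  assumes "bi_poly d f" shows "bi_poly d (\<lambda>x t s. mpoly_eval q x * f x t s)"
proof -
  from assms obtain c where "\<forall>x t s. t \<noteq> s \<longrightarrow>
      f x t s = (\<Sum>i<d. \<Sum>j<d. mpoly_eval (c i j) x * t ^ i * s ^ j)"
    unfolding bi_poly_def ..
  note c = this[rule_format]
  show ?thesis unfolding bi_poly_def
  proof (intro exI[of _ "\<lambda>i j. q * c i j"] allI impI)
    fix x :: "real^'a" and t s :: real assume ts: "t \<noteq> s"
    show "mpoly_eval q x * f x t s = (\<Sum>i<d. \<Sum>j<d. mpoly_eval (q * c i j) x * t ^ i * s ^ j)"
      by (simp only: c[OF ts] mpoly_eval_mult sum_distrib_left mult.assoc)
  qed
qed

lemma bi_poly_monomial: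
  assumes "a < d" "b < d" shows "bi_poly d (\<lambda>(x::real^'n::finite) t s. t ^ a * s ^ b)"
proof -
  have "t ^ a * s ^ b = (\<Sum>i<d. \<Sum>j<d. mpoly_eval (if i = a \<and> j = b then 1 else 0 :: 'n mpoly) x * t ^ i * s ^ j)"
    for x :: "real^'n" and t s :: real
  proof -
    have "(\<Sum>i<d. \<Sum>j<d. mpoly_eval (if i = a \<and> j = b then 1 else 0 :: 'n mpoly) x * t ^ i * s ^ j)
      = (\<Sum>i<d. \<Sum>j<d. if j = b then (if i = a then t ^ i * s ^ j else 0) else 0)"
      by (intro sum.cong) auto
    also have "\<dots> = t ^ a * s ^ b"
      using assms by (subst sum.delta) (auto simp: sum.delta)
    finally show ?thesis ..
  qed
  then show ?thesis unfolding bi_poly_def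
    by (intro exI[of _ "\<lambda>i j. if i = a \<and> j = b then 1 else 0"] allI impI)
qed

lemma bi_poly_cong:
  assumes "bi_poly d f" "\<And>x t s. t \<noteq> s \<Longrightarrow> f x t s = g x t s"
  shows "bi_poly d g"
proof -
  from assms(1) obtain c where "\<forall>x t s. t \<noteq> s \<longrightarrow>
      f x t s = (\<Sum>i<d. \<Sum>j<d. mpoly_eval (c i j) x * t ^ i * s ^ j)"
    unfolding bi_poly_def ..
  note c = this[rule_format]
  show ?thesis unfolding bi_poly_def
  proof (intro exI[of _ c] allI impI)
    fix x :: "real^'a" and t s :: real assume ts: "t \<noteq> s"
    show "g x t s = (\<Sum>i<d. \<Sum>j<d. mpoly_eval (c i j) x * t ^ i * s ^ j)"
      using assms(2)[OF ts] c[OF ts] by (rule trans[OF sym])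
  qed
qed

lemma bi_poly_quot_le:
  assumes "b \<le> a" "a \<le> d"
  shows "bi_poly d (\<lambda>(x::real^'n::finite) t s. (t ^ a * s ^ b - t ^ b * s ^ a) / (t - s))"
proof (rule bi_poly_cong)
  let ?f = "\<lambda>(x::real^'n) t s. \<Sum>k<a-b. t ^ (b + k) * s ^ (b + (a - b - Suc k))"
  show "bi_poly d ?f" by (intro bi_poly_sum bi_poly_monomial) (use assms in auto)
  fix x :: "real^'n" and t s :: real assume ts: "t \<noteq> s"
  have e: "t ^ a = t ^ b * t ^ (a - b)" "s ^ a = s ^ b * s ^ (a - b)"
    using assms by (simp_all flip: power_add)
  have "t ^ a * s ^ b - t ^ b * s ^ a = t ^ b * s ^ b * (t ^ (a - b) - s ^ (a - b))"
    unfolding e by (simp add: algebra_simps)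
  also have "\<dots> = t ^ b * s ^ b * ((t - s) * (\<Sum>k<a-b. s ^ (a - b - Suc k) * t ^ k))"
    by (simp only: power_diff_sumr2[of t "a - b" s])
  also have "\<dots> = (t - s) * ?f x t s"
    by (simp only: sum_distrib_left power_add mult_ac)
  finally show "?f x t s = (t ^ a * s ^ b - t ^ b * s ^ a) / (t - s)"
    using ts by (intro eq_divide_imp) (simp_all only: mult.commute right_minus_eq not_False_eq_True)
qed

lemma bi_poly_quot:
  assumes "a \<le> d" "b \<le> d"
  shows "bi_poly d (\<lambda>(x::real^'n::finite) t s. (t ^ a * s ^ b - t ^ b * s ^ a) / (t - s))"
proof (cases "b \<le> a")
  case False
  have "bi_poly d (\<lambda>(x::real^'n) t s. mpoly_eval (-1) x * ((t ^ b * s ^ a - t ^ a * s ^ b) / (t - s)))"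
    using bi_poly_mult[OF bi_poly_quot_le[of a b d], of "-1"] False assms by simp
  then show ?thesis
    by (rule bi_poly_cong)
      (simp only: mpoly_eval_uminus mpoly_eval_1 mult_minus_left mult_1 minus_divide_left minus_diff_eq)
qed (use assms bi_poly_quot_le in blast)

lemma ex1_bezoutian:
  fixes p :: "'n::finite mpoly"
  assumes "homogeneous d p"
  shows "\<exists>!B. is_bezoutian d p e u B"
proof -
  obtain a where a: "\<And>x t. mpoly_eval p (x + t *\<^sub>R e) = (\<Sum>k<Suc d. mpoly_eval (a k) x * t ^ k)"
    using line_poly_homogeneous[OF assms, of e] unfolding line_poly_def by metis
  obtain b where b: "\<And>x t. mpoly_eval (dir_deriv u p) (x + t *\<^sub>R e) = (\<Sum>k<d. mpoly_eval (b k) x * t ^ k)"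
    using line_poly_dir_deriv[OF assms, of e u] unfolding line_poly_def by metis
  let ?N = "\<lambda>x t s. (mpoly_eval p (x + t *\<^sub>R e) * mpoly_eval (dir_deriv u p) (x + s *\<^sub>R e)
           - mpoly_eval (dir_deriv u p) (x + t *\<^sub>R e) * mpoly_eval p (x + s *\<^sub>R e)) / (t - s)"
  have "bi_poly d ?N"
  proof (rule bi_poly_cong)
    let ?f = "\<lambda>x t s. \<Sum>k<Suc d. \<Sum>l<d. mpoly_eval (a k * b l) x * ((t ^ k * s ^ l - t ^ l * s ^ k) / (t - s))"
    show "bi_poly d ?f"
      by (intro bi_poly_sum bi_poly_mult bi_poly_quot) auto
    fix x :: "real^'n" and t s :: real
    have 1: "mpoly_eval p (x + t *\<^sub>R e) * mpoly_eval (dir_deriv u p) (x + s *\<^sub>R e)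
      = (\<Sum>k<Suc d. \<Sum>l<d. mpoly_eval (a k * b l) x * (t ^ k * s ^ l))"
      unfolding a b sum_product by (intro sum.cong refl) (simp add: mult_ac)
    have 2: "mpoly_eval (dir_deriv u p) (x + t *\<^sub>R e) * mpoly_eval p (x + s *\<^sub>R e)
      = (\<Sum>k<Suc d. \<Sum>l<d. mpoly_eval (a k * b l) x * (t ^ l * s ^ k))"
      unfolding a b sum_product by (subst sum.swap, intro sum.cong refl) (simp add: mult_ac)
    show "?f x t s = ?N x t s"
      unfolding 1 2 by (simp only: sum_subtractf[symmetric] right_diff_distrib[symmetric]
          sum_divide_distrib times_divide_eq_right)
  qed
  then obtain c where "\<forall>x t s. t \<noteq> s \<longrightarrow>
      ?N x t s = (\<Sum>i<d. \<Sum>j<d. mpoly_eval (c i j) x * t ^ i * s ^ j)"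
    unfolding bi_poly_def ..
  note c = this[rule_format]
  have "is_bezoutian d p e u (Matrix.mat d d (\<lambda>(i, j). c i j))"
    unfolding is_bezoutian_def
  proof (intro conjI allI impI)
    fix x :: "real^'n" and t s :: real assume "t \<noteq> s"
    then show "?N x t s
        = (\<Sum>i<d. \<Sum>j<d. mpoly_eval (Matrix.mat d d (\<lambda>(i, j). c i j) $$ (i, j)) x * t ^ i * s ^ j)"
      by (subst c) simp_all
  qed simp
  note B = this
  show ?thesis by (rule ex1I, rule B) (rule bezoutian_unique[OF _ B])
qed

lemma bezoutian_is_bezoutian:
  "homogeneous d p \<Longrightarrow> is_bezoutian d p e u (bezoutian d p e u)"
  unfolding bezoutian_def by (rule theI') (rule ex1_bezoutian)

end

theory Submission
  imports Defs
begin

text \<open>A thirteen-variable cubic separates the two classes. For real \<open>a, b, c\<close>, vectors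
  \<open>x, y\<close> with three entries and \<open>z = (z\<^sub>0, z\<^sub>1, z\<^sub>2, z\<^sub>3)\<close>, put \<open>Q(z) = 2 z\<^sub>0\<^sup>2 + z\<^sub>1\<^sup>2 + z\<^sub>2\<^sup>2 + z\<^sub>3\<^sup>2\<close> and
  \<open>T = z\<^sub>0 (x \<bullet> y) + z\<^sub>1 x\<^sub>1 y\<^sub>3 + z\<^sub>2 x\<^sub>2 y\<^sub>1 + z\<^sub>3 x\<^sub>3 y\<^sub>2\<close>, and consider
  \<open>p = a b c - a |x|\<^sup>2 - b |y|\<^sup>2 - c Q(z) + 2 T\<close>.

  Hyperbolicity. Whenever \<open>T\<^sup>2 \<le> |x|\<^sup>2 |y|\<^sup>2 Q(z)\<close>, the value of \<open>p\<close> is the determinant of a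
  Hermitian \<open>3 \<times> 3\<close> matrix with diagonal \<open>a, b, c\<close> and off-diagonal moduli \<open>|x|, |y|, \<surd>Q(z)\<close>; so
  \<open>p\<close> is hyperbolic in the direction \<open>a = b = c = 1\<close> (\<open>hermitian_cubic_real_rooted\<close>). The required
  inequality holds for all \<open>x, y, z\<close> (\<open>trilinear_bound\<close>). Maximising over \<open>z\<close>, it says that the
  biquadratic form \<open>F(x, y) = |x|\<^sup>2 |y|\<^sup>2 - (x \<bullet> y)\<^sup>2 / 2 - x\<^sub>1\<^sup>2 y\<^sub>3\<^sup>2 - x\<^sub>2\<^sup>2 y\<^sub>1\<^sup>2 - x\<^sub>3\<^sup>2 y\<^sub>2\<^sup>2\<close>, of the type
  studied by Choi and Lam, is nonnegative.

  Failure of the sum of squares property. The point \<open>u\<close> with \<open>a = 1\<close> and all other coordinates \<open>0\<close>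
  lies in the hyperbolicity cone. The corner entry of the Bezoutian is
  \<open>D\<^sub>e p D\<^sub>u p - p D\<^sub>e D\<^sub>u p\<close> (\<open>bezoutian_corner\<close>), and it is a sum of squares of polynomials if the
  Bezoutian is a matrix sum of squares. Restrict it to \<open>a = b = 0\<close>, \<open>c = L\<close>, \<open>y = L \<eta>\<close>, with \<open>z\<close> the
  maximiser of \<open>2 T(x, \<eta>, z) - Q(z)\<close>: the result is \<open>G(x, \<eta>) + L\<^sup>2 F(x, \<eta>)\<close>. Each square
  is then the square of a polynomial of degree at most one in \<open>L\<close>, and comparing coefficients of
  \<open>L\<^sup>2\<close> shows that \<open>F\<close> is a sum of squares of polynomials on that family. For \<open>x = (X, Y, 1)\<close> and
  \<open>\<eta> = (Y, X, X Y)\<close> it becomes \<open>X\<^sup>4 + X\<^sup>2 Y\<^sup>4 + Y\<^sup>2 - 3/2 X\<^sup>2 Y\<^sup>2\<close>, which is not a sum of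
  squares (\<open>motzkin_type_not_sos\<close>).

  Any nonzero \<open>e\<close> in a space of dimension at least \<open>13\<close> is moved to the direction
  \<open>a = b = c = 1\<close> by a linear change of coordinates (\<open>biorthogonal_system\<close>).\<close>

section \<open>A polynomial that is not a sum of squares\<close>

lemma real_polynomial_function_growth:
  fixes f :: "real \<Rightarrow> real"
  assumes f: "real_polynomial_function f"
    and bound: "\<And>t. (f t)\<^sup>2 \<le> K * (1 + t\<^sup>2) ^ d"
  shows "\<exists>q. degree q \<le> d \<and> f = poly q"
proof -
  obtain a n where a: "f = (\<lambda>t. \<Sum>i\<le>n. a i * t ^ i)"
    using f unfolding real_polynomial_function_iff_sum by blast
  define q where "q = (\<Sum>i\<le>n. monom (a i) i)"
  have fq: "f = poly q"
    unfolding a q_def by (simp add: fun_eq_iff poly_sum poly_monom)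
  have "degree q \<le> d"
  proof (rule ccontr)
    assume "\<not> degree q \<le> d"
    then have deg: "d < degree q" by simp
    define b where "b = smult K ([:1, 0, 1:] ^ d)"
    have "degree b \<le> 2 * d"
      unfolding b_def using degree_smult_le[of K "[:1, 0, 1:] ^ d"]
        degree_power_le[of "[:1, 0, 1::real:]" d] by simp
    also have "2 * d < degree (q\<^sup>2)"
    proof -
      have "q \<noteq> 0" using deg by auto
      then show ?thesis using deg by (simp add: power2_eq_square degree_mult_eq)
    qed
    finally have less: "degree b < degree (q\<^sup>2)" .
    then have "degree (q\<^sup>2 - b) = degree (q\<^sup>2)"
      using degree_add_eq_left[of "- b" "q\<^sup>2"] by (simp only: degree_minus diff_conv_add_uminus)
    then have "lead_coeff (q\<^sup>2 - b) = lead_coeff (q\<^sup>2)"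
      using coeff_eq_0[OF less] by (simp only: coeff_diff diff_zero)
    moreover have "lead_coeff (q\<^sup>2) > 0"
      using deg by (auto simp: lead_coeff_power)
    ultimately have pos: "lead_coeff (q\<^sup>2 - b) > 0" by simp
    then obtain N where "\<forall>t\<ge>N. poly (q\<^sup>2 - b) t \<ge> lead_coeff (q\<^sup>2 - b)"
      using poly_pinfty_gt_lc by blast
    then have "poly (q\<^sup>2 - b) N > 0" using pos by fastforce
    then have "K * (1 + N\<^sup>2) ^ d < (f N)\<^sup>2"
      by (simp add: b_def fq power2_eq_square)
    then show False using bound[of N] by simp
  qed
  with fq show ?thesis by blast
qed

lemma poly_degree_le_2:
  fixes q :: "real poly"
  assumes "degree q \<le> 2"
  shows "poly q t = coeff q 0 + coeff q 1 * t + coeff q 2 * t\<^sup>2"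
proof -
  have "poly q t = (\<Sum>i\<le>2. coeff q i * t ^ i)"
    using poly_as_sum_of_monoms'[OF assms] by (metis (no_types, lifting) poly_monom poly_sum sum.cong)
  then show ?thesis by (simp add: numeral_2_eq_2)
qed

lemma poly_degree_le_1:
  fixes q :: "real poly"
  assumes "degree q \<le> 1"
  shows "poly q t = coeff q 0 + coeff q 1 * t"
  using poly_degree_le_2[of q t] assms by (simp add: coeff_eq_0)

text \<open>As a polynomial in \<open>X\<close>, each summand is \<open>A + B X + C X\<^sup>2\<close> with coefficients depending on \<open>Y\<close>.
  The growth of the sum forces \<open>A\<close> to be a multiple of \<open>Y\<close> and \<open>C\<close> to be constant, so the
  products \<open>A C\<close> cancel when the coefficients of \<open>X\<^sup>2\<close> at \<open>Y = 1\<close> and \<open>Y = -1\<close> are added. What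
  remains equates the sum of the \<open>B\<^sup>2\<close> with the negative number \<open>2 (1 - 3/2)\<close>.\<close>

lemma motzkin_type_not_sos:
  fixes f :: "nat \<Rightarrow> real \<Rightarrow> real \<Rightarrow> real"
  assumes X: "\<And>m Y. real_polynomial_function (\<lambda>X. f m X Y)"
    and Y: "\<And>m X. real_polynomial_function (\<lambda>Y. f m X Y)"
    and sos: "\<And>X Y. (\<Sum>m<k. (f m X Y)\<^sup>2) = X ^ 4 + X\<^sup>2 * Y ^ 4 + Y\<^sup>2 - 3 / 2 * X\<^sup>2 * Y\<^sup>2"
  shows False
proof -
  have sq: "(f m X Y)\<^sup>2 \<le> X ^ 4 + X\<^sup>2 * Y ^ 4 + Y\<^sup>2" if "m < k" for m X Y
  proof -
    have "(f m X Y)\<^sup>2 \<le> (\<Sum>m<k. (f m X Y)\<^sup>2)"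
      using that by (intro member_le_sum) auto
    also have "\<dots> \<le> X ^ 4 + X\<^sup>2 * Y ^ 4 + Y\<^sup>2"
      unfolding sos by simp
    finally show ?thesis .
  qed
  \<comment> \<open>the three coefficients in \<open>X\<close>, recovered by interpolation at \<open>0, 1, -1\<close>\<close>
  define A where "A m Y = f m 0 Y" for m Y
  define B where "B m Y = (f m 1 Y - f m (-1) Y) / 2" for m Y
  define C where "C m Y = (f m 1 Y + f m (-1) Y - 2 * f m 0 Y) / 2" for m Y
  have decomp: "f m X Y = A m Y + B m Y * X + C m Y * X\<^sup>2" if m: "m < k" for m X Y
  proof -
    have "X ^ 4 + X\<^sup>2 * Y ^ 4 + Y\<^sup>2 \<le> (1 + Y\<^sup>2 + Y ^ 4) * (1 + X\<^sup>2)\<^sup>2" for X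
    proof -
      have "0 \<le> 1 + 2 * X\<^sup>2 + Y\<^sup>2 * (2 * X\<^sup>2 + X ^ 4) + Y ^ 4 * (1 + X\<^sup>2 + X ^ 4)"
        by (intro add_nonneg_nonneg mult_nonneg_nonneg) auto
      then show ?thesis by (simp add: algebra_simps power2_eq_square power4_eq_xxxx)
    qed
    then have "(f m X Y)\<^sup>2 \<le> (1 + Y\<^sup>2 + Y ^ 4) * (1 + X\<^sup>2) ^ 2" for X
      using sq[OF m, of X Y] order_trans by blast
    from real_polynomial_function_growth[OF X this]
    obtain q where "degree q \<le> 2" "\<And>X. f m X Y = poly q X" by (metis (no_types))
    then have q: "f m X Y = coeff q 0 + coeff q 1 * X + coeff q 2 * X\<^sup>2" for X
      by (simp add: poly_degree_le_2)
    have "A m Y = coeff q 0" "B m Y = coeff q 1" "C m Y = coeff q 2"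
      by (simp_all add: A_def B_def C_def q)
    with q show ?thesis by simp
  qed
  have coeffs: "(\<Sum>m<k. (C m Y)\<^sup>2) = 1"
    "(\<Sum>m<k. (B m Y)\<^sup>2) + 2 * (\<Sum>m<k. A m Y * C m Y) = Y ^ 4 - 3 / 2 * Y\<^sup>2" for Y
  proof -
    \<comment> \<open>coefficients in \<open>X\<close> of the difference of the two sides\<close>
    define c where "c i = (if i = 0 then (\<Sum>m<k. (A m Y)\<^sup>2) - Y\<^sup>2
      else if i = 1 then 2 * (\<Sum>m<k. A m Y * B m Y)
      else if i = 2 then (\<Sum>m<k. (B m Y)\<^sup>2) + 2 * (\<Sum>m<k. A m Y * C m Y) - (Y ^ 4 - 3 / 2 * Y\<^sup>2)
      else if i = 3 then 2 * (\<Sum>m<k. B m Y * C m Y)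
      else (\<Sum>m<k. (C m Y)\<^sup>2) - 1)" for i :: nat
    have 0: "(\<Sum>i\<le>4. c i * X ^ i) = 0" for X
    proof -
      have "(\<Sum>m<k. (f m X Y)\<^sup>2) = (\<Sum>m<k. (A m Y)\<^sup>2 + 2 * (A m Y * B m Y) * X
          + ((B m Y)\<^sup>2 + 2 * (A m Y * C m Y)) * X\<^sup>2 + 2 * (B m Y * C m Y) * X ^ 3
          + (C m Y)\<^sup>2 * X ^ 4)"
        by (intro sum.cong refl)
          (simp add: decomp, simp add: algebra_simps power2_eq_square power3_eq_cube power4_eq_xxxx)
      also have "\<dots> = (\<Sum>i\<le>4. c i * X ^ i) + (X ^ 4 + X\<^sup>2 * Y ^ 4 + Y\<^sup>2 - 3 / 2 * X\<^sup>2 * Y\<^sup>2)"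
        by (simp add: c_def eval_nat_numeral sum.distrib sum_distrib_left sum_distrib_right algebra_simps)
      finally show ?thesis unfolding sos by simp
    qed
    have "c i = 0" if "i \<le> 4" for i
      by (rule poly_fun_0_coeff[of UNIV c 4]) (use that 0 in \<open>simp_all add: infinite_UNIV_char_0\<close>)
    from this[of 2] this[of 4] show "(\<Sum>m<k. (C m Y)\<^sup>2) = 1"
      "(\<Sum>m<k. (B m Y)\<^sup>2) + 2 * (\<Sum>m<k. A m Y * C m Y) = Y ^ 4 - 3 / 2 * Y\<^sup>2"
      by (simp_all add: c_def)
  qed
  have A: "A m (-1) = - A m 1" if m: "m < k" for m
  proof -
    have b: "(A m Y)\<^sup>2 \<le> Y\<^sup>2" for Y
      unfolding A_def using sq[OF m, of 0 Y] by simp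
    then have "(A m Y)\<^sup>2 \<le> 1 * (1 + Y\<^sup>2) ^ 1" for Y
      by (rule order_trans) simp
    moreover have "real_polynomial_function (A m)" unfolding A_def[abs_def] by (rule Y)
    ultimately obtain q where q: "degree q \<le> 1" "A m = poly q"
      using real_polynomial_function_growth by blast
    have "coeff q 0 = 0" using b[of 0] q by (simp add: poly_0_coeff_0)
    then show ?thesis using q by (simp add: poly_degree_le_1)
  qed
  have C: "C m (-1) = C m 1" if m: "m < k" for m
  proof -
    have "(C m Y)\<^sup>2 \<le> 1 * (1 + Y\<^sup>2) ^ 0" for Y
      using member_le_sum[of m "{..<k}" "\<lambda>m. (C m Y)\<^sup>2"] m coeffs(1)[of Y] by simp
    moreover have "real_polynomial_function (C m)"
      unfolding C_def[abs_def] by (intro real_polynomial_function_divide real_polynomial_function_diff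
        real_polynomial_function.intros(2,3,4) Y)
    ultimately obtain q where q: "degree q \<le> 0" "C m = poly q"
      using real_polynomial_function_growth by blast
    have "degree q \<le> 1" using q(1) by simp
    moreover have "coeff q 1 = 0" using q(1) by (intro coeff_eq_0) simp
    ultimately show ?thesis using q(2) by (simp add: poly_degree_le_1)
  qed
  have "(\<Sum>m<k. A m (-1) * C m (-1)) = - (\<Sum>m<k. A m 1 * C m 1)"
    using A C by (simp flip: sum_negf)
  with coeffs(2)[of 1] coeffs(2)[of "-1"]
  have "(\<Sum>m<k. (B m 1)\<^sup>2) + (\<Sum>m<k. (B m (-1))\<^sup>2) = -1" by simp
  moreover have "(\<Sum>m<k. (B m 1)\<^sup>2) + (\<Sum>m<k. (B m (-1))\<^sup>2) \<ge> 0"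
    by (intro add_nonneg_nonneg sum_nonneg) auto
  ultimately show False by simp
qed

section \<open>Hyperbolicity of the cubic\<close>

text \<open>The hypothesis makes the coefficients of \<open>y\<^sub>2\<^sup>2\<close> and \<open>y\<^sub>3\<^sup>2\<close> at least \<open>x\<^sub>2\<^sup>2 + x\<^sub>3\<^sup>2\<close>, so that the
  Cauchy-Schwarz inequality applies to the last two summands on the left.\<close>

lemma biquadratic_bound_case:
  fixes x1 x2 x3 y1 y2 y3 :: real
  assumes "x3\<^sup>2 \<le> x1\<^sup>2"
  shows "(x1 * y1 + x2 * y2 + x3 * y3)\<^sup>2 \<le> 2 * ((x1\<^sup>2 + x3\<^sup>2) * y1\<^sup>2 + (x2\<^sup>2 + x1\<^sup>2) * y2\<^sup>2 + (x3\<^sup>2 + x2\<^sup>2) * y3\<^sup>2)"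
proof -
  have "(x1 * y1 + x2 * y2 + x3 * y3)\<^sup>2 \<le> 2 * ((x1 * y1)\<^sup>2 + (x2 * y2 + x3 * y3)\<^sup>2)"
    using sum_squares_bound[of "x1 * y1" "x2 * y2 + x3 * y3"]
    by (simp add: power2_sum[of "x1 * y1" "x2 * y2 + x3 * y3"] add.assoc)
  also have "(x2 * y2 + x3 * y3)\<^sup>2 \<le> (x2\<^sup>2 + x3\<^sup>2) * (y2\<^sup>2 + y3\<^sup>2)"
    using zero_le_power2[of "x2 * y3 - x3 * y2"] by (simp add: algebra_simps power2_eq_square)
  also have "\<dots> \<le> (x2\<^sup>2 + x1\<^sup>2) * y2\<^sup>2 + (x3\<^sup>2 + x2\<^sup>2) * y3\<^sup>2"
    using mult_right_mono[OF assms, of "y2\<^sup>2"] by (simp add: algebra_simps)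
  also have "(x1 * y1)\<^sup>2 \<le> (x1\<^sup>2 + x3\<^sup>2) * y1\<^sup>2"
    by (simp add: power_mult_distrib algebra_simps)
  finally show ?thesis by (simp add: algebra_simps)
qed

text \<open>Nonnegativity of twice the biquadratic form. Both sides are invariant under cyclic shifts
  of the indices, and one of the squares \<open>x\<^sub>i\<^sup>2\<close> is at least its cyclic predecessor.\<close>

lemma biquadratic_bound:
  fixes x1 x2 x3 y1 y2 y3 :: real
  shows "(x1 * y1 + x2 * y2 + x3 * y3)\<^sup>2 \<le> 2 * ((x1\<^sup>2 + x3\<^sup>2) * y1\<^sup>2 + (x2\<^sup>2 + x1\<^sup>2) * y2\<^sup>2 + (x3\<^sup>2 + x2\<^sup>2) * y3\<^sup>2)"
proof -
  consider "x3\<^sup>2 \<le> x1\<^sup>2" | "x1\<^sup>2 \<le> x2\<^sup>2" | "x2\<^sup>2 \<le> x3\<^sup>2" by linarith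
  then show ?thesis
  proof cases
    case 1 then show ?thesis by (rule biquadratic_bound_case)
  next
    case 2 from biquadratic_bound_case[OF this, of y2 x3 y3 y1] show ?thesis by (simp add: add_ac)
  next
    case 3 from biquadratic_bound_case[OF this, of y3 x1 y1 y2] show ?thesis by (simp add: add_ac)
  qed
qed

lemma trilinear_bound:
  fixes x1 x2 x3 y1 y2 y3 z0 z1 z2 z3 :: real
  shows "(z0 * (x1 * y1 + x2 * y2 + x3 * y3) + z1 * (x1 * y3) + z2 * (x2 * y1) + z3 * (x3 * y2))\<^sup>2
    \<le> (x1\<^sup>2 + x2\<^sup>2 + x3\<^sup>2) * (y1\<^sup>2 + y2\<^sup>2 + y3\<^sup>2) * (2 * z0\<^sup>2 + z1\<^sup>2 + z2\<^sup>2 + z3\<^sup>2)"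
proof -
  have CS: "(z0 * s + z1 * p + z2 * q + z3 * r)\<^sup>2
      \<le> (s\<^sup>2 / 2 + p\<^sup>2 + q\<^sup>2 + r\<^sup>2) * (2 * z0\<^sup>2 + z1\<^sup>2 + z2\<^sup>2 + z3\<^sup>2)" for s p q r :: real
  proof -
    have "0 \<le> 2 * (z0 * p - s * z1 / 2)\<^sup>2 + 2 * (z0 * q - s * z2 / 2)\<^sup>2 + 2 * (z0 * r - s * z3 / 2)\<^sup>2
       + (z1 * q - z2 * p)\<^sup>2 + (z1 * r - z3 * p)\<^sup>2 + (z2 * r - z3 * q)\<^sup>2" by simp
    then show ?thesis by (simp add: power2_eq_square algebra_simps)
  qed
  have "(x1 * y1 + x2 * y2 + x3 * y3)\<^sup>2 / 2 + (x1 * y3)\<^sup>2 + (x2 * y1)\<^sup>2 + (x3 * y2)\<^sup>2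
      \<le> (x1\<^sup>2 + x2\<^sup>2 + x3\<^sup>2) * (y1\<^sup>2 + y2\<^sup>2 + y3\<^sup>2)"
    using biquadratic_bound[of x1 y1 x2 y2 x3 y3] by (simp add: algebra_simps power_mult_distrib)
  then show ?thesis
    by (intro order_trans[OF CS] mult_right_mono) auto
qed

text \<open>The polynomial in \<open>t\<close> is \<open>det (H + t I)\<close> for a Hermitian matrix \<open>H\<close> with diagonal \<open>a, b, c\<close>,
  squared off-diagonal moduli \<open>p, q, r\<close>, and \<open>T\<close> the real part of the product of the three
  off-diagonal entries. The proof avoids \<open>H\<close>: the equation reads \<open>A N = q B + r C - 2 T\<close> with
  \<open>A, B, C\<close> the shifted diagonal entries and \<open>N = B C - p\<close>, and the imaginary part of this equation
  multiplied by the conjugate of \<open>N\<close> says that \<open>Im t\<close> times a sum of nonnegative terms,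
  one of them \<open>|N|\<^sup>2\<close>, equals \<open>0\<close>.
  For nonreal \<open>t\<close> this forces \<open>N = 0\<close>, which is impossible.\<close>

lemma hermitian_cubic_real_rooted:
  fixes a b c p q r T :: real and t :: complex
  assumes nonneg: "p \<ge> 0" "q \<ge> 0" "r \<ge> 0" and T: "T\<^sup>2 \<le> p * q * r"
    and root: "(of_real a + t) * (of_real b + t) * (of_real c + t) - of_real p * (of_real a + t)
      - of_real q * (of_real b + t) - of_real r * (of_real c + t) + 2 * of_real T = 0"
  shows "t \<in> \<real>"
proof (rule ccontr)
  define w where "w = Im t"
  define a' where "a' = a + Re t"
  define b' where "b' = b + Re t"
  define c' where "c' = c + Re t"
  assume "t \<notin> \<real>"
  then have w: "w \<noteq> 0" by (simp add: complex_is_Real_iff w_def)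
  define A where "A = Complex a' w"
  define B where "B = Complex b' w"
  define C where "C = Complex c' w"
  define N where "N = B * C - of_real p"
  have "A = of_real a + t" "B = of_real b + t" "C = of_real c + t"
    by (simp_all add: A_def B_def C_def a'_def b'_def c'_def w_def complex_eq_iff)
  with root have "A * N = of_real q * B + of_real r * C - 2 * of_real T"
    unfolding N_def by (simp add: algebra_simps)
  then have "A * N * cnj N = (of_real q * B + of_real r * C - 2 * of_real T) * cnj N" by simp
  then have "Im (A * N * cnj N) = Im ((of_real q * B + of_real r * C - 2 * of_real T) * cnj N)"
    by (rule arg_cong)
  moreover have "Im (A * N * cnj N) = w * ((Re N)\<^sup>2 + (Im N)\<^sup>2)"
    by (simp add: A_def algebra_simps power2_eq_square)
  moreover have "Im ((of_real q * B + of_real r * C - 2 * of_real T) * cnj N)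
      = - w * ((q * (b'\<^sup>2 + w\<^sup>2) + q * p) + (r * (c'\<^sup>2 + w\<^sup>2) + r * p) - 2 * T * (b' + c'))"
    by (simp add: N_def B_def C_def algebra_simps power2_eq_square)
  ultimately have "w * (((Re N)\<^sup>2 + (Im N)\<^sup>2) + ((q * (b'\<^sup>2 + w\<^sup>2) + q * p) + (r * (c'\<^sup>2 + w\<^sup>2) + r * p) - 2 * T * (b' + c'))) = 0"
    by (simp add: algebra_simps)
  then have eq: "((Re N)\<^sup>2 + (Im N)\<^sup>2) + ((q * (b'\<^sup>2 + w\<^sup>2) + q * p) + (r * (c'\<^sup>2 + w\<^sup>2) + r * p) - 2 * T * (b' + c')) = 0"
    using w by simp
  have amgm: "2 * T * v \<le> s * v\<^sup>2 + u" if "0 \<le> s" "0 \<le> u" "T\<^sup>2 \<le> s * u" for s u v :: real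
  proof (rule power2_le_imp_le)
    have "(2 * T * v)\<^sup>2 = 4 * (T\<^sup>2 * v\<^sup>2)" by (simp add: power_mult_distrib)
    also have "\<dots> \<le> 4 * (s * u * v\<^sup>2)" using mult_right_mono[OF that(3), of "v\<^sup>2"] by simp
    also have "\<dots> \<le> (s * v\<^sup>2 + u)\<^sup>2"
      using zero_le_power2[of "s * v\<^sup>2 - u"] by (simp add: power2_eq_square algebra_simps)
    finally show "(2 * T * v)\<^sup>2 \<le> (s * v\<^sup>2 + u)\<^sup>2" .
    show "0 \<le> s * v\<^sup>2 + u" using that by simp
  qed
  have "2 * T * b' \<le> q * b'\<^sup>2 + r * p" "2 * T * c' \<le> r * c'\<^sup>2 + q * p"
    using amgm[of q "r * p" b'] amgm[of r "q * p" c'] nonneg T by (simp_all add: mult_ac)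
  moreover have "0 \<le> q * w\<^sup>2" "0 \<le> r * w\<^sup>2" using nonneg by simp_all
  ultimately have "(Re N)\<^sup>2 + (Im N)\<^sup>2 \<le> 0" using eq by (simp add: algebra_simps)
  then have N0: "Re N = 0" "Im N = 0" by (simp_all add: sum_power2_le_zero_iff)
  then have "(b' + c') * w = 0" by (simp add: N_def B_def C_def algebra_simps)
  then have "c' = - b'" using w by simp
  then have "Re N = - (b'\<^sup>2 + w\<^sup>2 + p)" by (simp add: N_def B_def C_def power2_eq_square)
  moreover have "b'\<^sup>2 + w\<^sup>2 + p > 0" using w nonneg by (simp add: add_nonneg_pos add_pos_nonneg)
  ultimately show False using N0 by simp
qed

section \<open>Linear forms, derivatives and the corner of the Bezoutian\<close>

lemma homogeneous_add: "homogeneous d p \<Longrightarrow> homogeneous d q \<Longrightarrow> homogeneous d (p + q)"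
  unfolding homogeneous_def using keys_add[of p q] by blast

lemma homogeneous_diff: "homogeneous d p \<Longrightarrow> homogeneous d q \<Longrightarrow> homogeneous d (p - q)"
  using keys_diff[of p q] unfolding homogeneous_def by blast

lemma homogeneous_mult:
  assumes "homogeneous c p" "homogeneous d q"
  shows "homogeneous (c + d) (p * q)"
  unfolding homogeneous_def
proof
  fix m assume "m \<in> Poly_Mapping.keys (p * q)"
  then obtain a b where "m = a + b" "a \<in> Poly_Mapping.keys p" "b \<in> Poly_Mapping.keys q"
    using keys_mult[of p q] by blast
  then show "(\<Sum>i\<in>UNIV. Poly_Mapping.lookup m i) = c + d"
    using assms by (simp add: homogeneous_def lookup_add sum.distrib)
qed

text \<open>The linear form \<open>x \<mapsto> w \<bullet> x\<close> as a polynomial.\<close>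

definition lin_form :: "real^'n \<Rightarrow> 'n::finite mpoly" where
  "lin_form w = (\<Sum>i\<in>UNIV. Poly_Mapping.single (Poly_Mapping.single i 1) (w $ i))"

lemma homogeneous_lin_form: "homogeneous (Suc 0) (lin_form w)"
  unfolding homogeneous_def
proof
  fix m assume "m \<in> Poly_Mapping.keys (lin_form w)"
  then obtain i where "m \<in> Poly_Mapping.keys (Poly_Mapping.single (Poly_Mapping.single i (1::nat)) (w $ i))"
    using keys_sum[of "\<lambda>i. Poly_Mapping.single (Poly_Mapping.single i (1::nat)) (w $ i)" UNIV]
    unfolding lin_form_def by blast
  then have "m = Poly_Mapping.single i 1" by (auto split: if_splits)
  then show "(\<Sum>i\<in>UNIV. Poly_Mapping.lookup m i) = Suc 0"
    by (simp add: lookup_single when_def)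
qed

lemma mpoly_eval_lin_form: "mpoly_eval (lin_form w) x = (\<Sum>i\<in>UNIV. w $ i *\<^sub>R x $ i)"
proof -
  have "(\<Prod>j\<in>UNIV. (x $ j) ^ Poly_Mapping.lookup (Poly_Mapping.single i 1) j) = x $ i" for i
  proof -
    have "(\<Prod>j\<in>UNIV. (x $ j) ^ Poly_Mapping.lookup (Poly_Mapping.single i 1) j)
        = (\<Prod>j\<in>UNIV. if j = i then x $ i else 1)"
      by (intro prod.cong refl) (auto simp: lookup_single when_def)
    then show ?thesis by simp
  qed
  then show ?thesis by (simp add: lin_form_def)
qed

lemma mpoly_eval_lin_form_real: "mpoly_eval (lin_form w) x = w \<bullet> (x :: real^'n)"
  by (simp add: mpoly_eval_lin_form inner_vec_def)

lemma mpoly_eval_lin_form_complex_line: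
  fixes x e :: "real^'n"
  shows "mpoly_eval (lin_form w) (\<chi> i. of_real (x $ i) + (t :: complex) * of_real (e $ i))
    = of_real (w \<bullet> x) + t * of_real (w \<bullet> e)"
  by (simp add: mpoly_eval_lin_form inner_vec_def scaleR_conv_of_real sum.distrib
      sum_distrib_left algebra_simps)

lemma has_real_derivative_mpoly_eval_line:
  fixes p :: "'n::finite mpoly" and x u :: "real^'n"
  shows "((\<lambda>t. mpoly_eval p (x + t *\<^sub>R u)) has_real_derivative mpoly_eval (dir_deriv u p) x) (at 0)"
proof -
  let ?l = Poly_Mapping.lookup
  have mono: "((\<lambda>t. ?l p m * (\<Prod>i\<in>UNIV. ((x + t *\<^sub>R u) $ i) ^ ?l m i)) has_real_derivative
      (\<Sum>i\<in>UNIV. u $ i * (of_nat (?l m i) * ?l p m *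
        (\<Prod>j\<in>UNIV. (x $ j) ^ ?l (m - Poly_Mapping.single i 1) j)))) (at 0)" for m
  proof -
    have "((\<lambda>t. ?l p m * (\<Prod>i\<in>UNIV. ((x + t *\<^sub>R u) $ i) ^ ?l m i)) has_real_derivative
      ?l p m * (\<Sum>i\<in>UNIV. of_nat (?l m i) * u $ i * (x $ i) ^ (?l m i - 1) *
        (\<Prod>j\<in>UNIV - {i}. ((x + 0 *\<^sub>R u) $ j) ^ ?l m j))) (at 0)"
      by (intro DERIV_cmult has_field_derivative_prod) (auto intro!: derivative_eq_intros)
    moreover have "(\<Prod>j\<in>UNIV. (x $ j) ^ ?l (m - Poly_Mapping.single i 1) j)
        = (x $ i) ^ (?l m i - 1) * (\<Prod>j\<in>UNIV - {i}. (x $ j) ^ ?l m j)" for i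
      by (subst prod.remove[of UNIV i])
        (auto simp: lookup_minus lookup_single when_def intro!: prod.cong)
    ultimately show ?thesis
      by (simp add: sum_distrib_left mult_ac)
  qed
  have "((\<lambda>t. \<Sum>m\<in>Poly_Mapping.keys p. ?l p m * (\<Prod>i\<in>UNIV. ((x + t *\<^sub>R u) $ i) ^ ?l m i))
      has_real_derivative (\<Sum>m\<in>Poly_Mapping.keys p. \<Sum>i\<in>UNIV. u $ i * (of_nat (?l m i) * ?l p m *
        (\<Prod>j\<in>UNIV. (x $ j) ^ ?l (m - Poly_Mapping.single i 1) j)))) (at 0)"
    by (intro DERIV_sum mono)
  moreover have "mpoly_eval (dir_deriv u p) x = (\<Sum>m\<in>Poly_Mapping.keys p. \<Sum>i\<in>UNIV.
      u $ i * (of_nat (?l m i) * ?l p m *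
        (\<Prod>j\<in>UNIV. (x $ j) ^ ?l (m - Poly_Mapping.single i 1) j)))"
    by (subst sum.swap) (simp add: dir_deriv_def partial_deriv_def sum_distrib_left)
  ultimately show ?thesis by (simp only: mpoly_eval_def[of p] real_scaleR_def)
qed

lemma mpoly_eval_dir_deriv_eqI:
  fixes x u :: "real^'n"
  assumes "((\<lambda>t. mpoly_eval p (x + t *\<^sub>R u)) has_real_derivative D) (at 0)"
  shows "mpoly_eval (dir_deriv u p) x = D"
  using DERIV_unique[OF has_real_derivative_mpoly_eval_line assms] .

text \<open>The constant coefficient of the Bezoutian is its limit at \<open>s = 0\<close> as \<open>t\<close> tends to \<open>0\<close>, which
  is a derivative in the direction \<open>e\<close>.\<close>

lemma bezoutian_corner:
  fixes p :: "'n::finite mpoly" and x e u :: "real^'n"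
  assumes p: "homogeneous d p" and d: "d > 0"
  shows "mpoly_eval (bezoutian d p e u $$ (0, 0)) x
    = mpoly_eval (dir_deriv e p) x * mpoly_eval (dir_deriv u p) x
      - mpoly_eval p x * mpoly_eval (dir_deriv e (dir_deriv u p)) x"
proof -
  let ?b = "\<lambda>i j. mpoly_eval (bezoutian d p e u $$ (i, j)) x"
  let ?f = "\<lambda>t. mpoly_eval p (x + t *\<^sub>R e) * mpoly_eval (dir_deriv u p) x
           - mpoly_eval (dir_deriv u p) (x + t *\<^sub>R e) * mpoly_eval p x"
  have "((\<lambda>t. ?f t) has_real_derivative mpoly_eval (dir_deriv e p) x * mpoly_eval (dir_deriv u p) x
      - mpoly_eval (dir_deriv e (dir_deriv u p)) x * mpoly_eval p x) (at 0)"
    by (intro DERIV_diff DERIV_cmult_right has_real_derivative_mpoly_eval_line)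
  then have lim1: "((\<lambda>t. ?f t / t) \<longlongrightarrow> mpoly_eval (dir_deriv e p) x * mpoly_eval (dir_deriv u p) x
      - mpoly_eval (dir_deriv e (dir_deriv u p)) x * mpoly_eval p x) (at 0)"
    by (simp add: has_field_derivative_iff)
  have eq: "?f t / t = (\<Sum>i<d. ?b i 0 * t ^ i)" if "t \<noteq> 0" for t
  proof -
    have "?f t / t = (\<Sum>i<d. \<Sum>j<d. ?b i j * t ^ i * 0 ^ j)"
      using bezoutian_is_bezoutian[OF p, of e u, unfolded is_bezoutian_def,
          THEN conjunct2, rule_format, OF that, of x]
      by (simp only: scaleR_zero_left add_0_right diff_zero)
    also have "\<dots> = (\<Sum>i<d. \<Sum>j<d. if j = 0 then ?b i 0 * t ^ i else 0)"
      by (intro sum.cong refl) auto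
    finally show ?thesis using d by simp
  qed
  have "((\<lambda>t. \<Sum>i<d. ?b i 0 * t ^ i) \<longlongrightarrow> (\<Sum>i<d. ?b i 0 * 0 ^ i)) (at 0)"
    by (intro tendsto_intros)
  moreover have "(\<Sum>i<d. ?b i 0 * 0 ^ i) = (\<Sum>i<d. if i = 0 then ?b 0 0 else 0)"
    by (intro sum.cong refl) auto
  ultimately have "((\<lambda>t. \<Sum>i<d. ?b i 0 * t ^ i) \<longlongrightarrow> ?b 0 0) (at 0)"
    using d by simp
  then have "((\<lambda>t. ?f t / t) \<longlongrightarrow> ?b 0 0) (at 0)"
    by (rule Lim_transform_eventually) (auto simp: eventually_at_filter eq)
  from tendsto_unique[OF _ this lim1] show ?thesis by (simp add: mult.commute)
qed

lemma real_polynomial_function_mpoly_eval: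
  fixes c :: "'a::real_normed_vector \<Rightarrow> real^'n::finite"
  assumes "\<And>i. real_polynomial_function (\<lambda>t. c t $ i)"
  shows "real_polynomial_function (\<lambda>t. mpoly_eval q (c t))"
  unfolding mpoly_eval_def real_scaleR_def
  by (intro real_polynomial_function_sum real_polynomial_function_prod real_polynomial_function_power
      real_polynomial_function.intros(2,4) assms) auto

section \<open>Coordinates adapted to the direction\<close>

text \<open>The functionals \<open>w i\<close> are coordinates on the span of the \<open>d j\<close> in which \<open>e\<close> has three
  coordinates equal to \<open>1\<close> and all others equal to \<open>0\<close>.\<close>

lemma biorthogonal_system:
  fixes e :: "real^'n"
  assumes e: "e \<noteq> 0" and N: "3 \<le> N" "N \<le> CARD('n)"
  obtains w d :: "nat \<Rightarrow> real^'n" where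
    "\<And>i j. i < N \<Longrightarrow> j < N \<Longrightarrow> w i \<bullet> d j = (if i = j then 1 else 0)"
    "e = d 0 + d 1 + d 2"
proof -
  obtain k where k: "e $ k \<noteq> 0" using e by (auto simp: vec_eq_iff)
  have "card {1..<N} \<le> card (UNIV - {k})" using N by (simp add: card_Diff_singleton)
  then obtain s where s: "s ` {1..<N} \<subseteq> UNIV - {k}" "inj_on s {1..<N}"
    using card_le_inj[of "{1..<N}" "UNIV - {k}"] by auto
  \<comment> \<open>the \<open>a j\<close> together with \<open>e\<close> are independent; \<open>h j\<close> and \<open>g\<close> are the dual functionals\<close>
  define a :: "nat \<Rightarrow> real^'n" where "a j = axis (s j) 1" for j
  define d where "d j = (if j = 0 then e - a 1 - a 2 else a j)" for j
  define g :: "real^'n" where "g = axis k (1 / e $ k)"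
  define h where "h j = a j - e $ s j *\<^sub>R g" for j
  define w where "w i = (if i = 0 then g else if i < 3 then h i + g else h i)" for i
  have sk: "s j \<noteq> k" "k \<noteq> s j" if "1 \<le> j" "j < N" for j using s(1) that by force+
  have axis_nth: "axis i (1::real) $ j = (if j = i then 1 else 0)" for i j :: 'n
    by (simp add: axis_def)
  have g: "g \<bullet> e = 1" "\<And>j. 1 \<le> j \<Longrightarrow> j < N \<Longrightarrow> g \<bullet> a j = 0"
    using k sk by (auto simp: g_def a_def inner_axis' axis_nth)
  have h: "h i \<bullet> e = 0" "h i \<bullet> a j = (if i = j then 1 else 0)"
    if "1 \<le> i" "i < N" "1 \<le> j" "j < N" for i j
    using that g s(2)
    by (auto simp: h_def inner_diff_left a_def inner_axis' axis_nth inj_on_eq_iff)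
  have "w i \<bullet> d j = (if i = j then 1 else 0)" if "i < N" "j < N" for i j
    using that N g h by (auto simp: w_def d_def inner_add_left inner_diff_right not_less Suc_le_eq)
  moreover have "e = d 0 + d 1 + d 2" by (simp add: d_def)
  ultimately show ?thesis using that by blast
qed

section \<open>The cubic form\<close>

text \<open>The cubic \<open>a b c - a |x|\<^sup>2 - b |y|\<^sup>2 - c Q(z) + 2 T\<close>, with variables numbered \<open>a, b, c = v 0, v 1, v 2\<close>,
  \<open>x = (v 3, v 4, v 5)\<close>, \<open>y = (v 6, v 7, v 8)\<close> and \<open>z = (v 9, \<dots>, v 12)\<close>. It is defined over any commutative
  ring, so that it can be formed from linear forms as well as from real and complex numbers.\<close>

definition cubic_form :: "(nat \<Rightarrow> 'a::comm_ring_1) \<Rightarrow> 'a" where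
  "cubic_form v = v 0 * v 1 * v 2
     - v 0 * (v 3 * v 3 + v 4 * v 4 + v 5 * v 5)
     - v 1 * (v 6 * v 6 + v 7 * v 7 + v 8 * v 8)
     - v 2 * (2 * (v 9 * v 9) + v 10 * v 10 + v 11 * v 11 + v 12 * v 12)
     + 2 * (v 9 * (v 3 * v 6 + v 4 * v 7 + v 5 * v 8)
          + v 10 * (v 3 * v 8) + v 11 * (v 4 * v 6) + v 12 * (v 5 * v 7))"

lemma mpoly_eval_cubic_form:
  "mpoly_eval (cubic_form f) x = cubic_form (\<lambda>i. mpoly_eval (f i) x)"
  by (simp only: cubic_form_def mult_2 mpoly_eval_add mpoly_eval_diff mpoly_eval_mult)

lemma homogeneous_cubic_form:
  assumes "\<And>i. homogeneous (Suc 0) (f i)"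
  shows "homogeneous 3 (cubic_form f)"
proof -
  have 2: "homogeneous 2 (p * q)" if "homogeneous (Suc 0) p" "homogeneous (Suc 0) q" for p q :: "'a mpoly"
    using homogeneous_mult[OF that] by (simp add: numeral_2_eq_2)
  have 3: "homogeneous 3 (p * q)" if "homogeneous (Suc 0) p" "homogeneous 2 q" for p q :: "'a mpoly"
    using homogeneous_mult[OF that] by (simp add: numeral_2_eq_2 numeral_3_eq_3)
  show ?thesis
    unfolding cubic_form_def mult_2 mult.assoc
    by (intro homogeneous_add homogeneous_diff 2 3 assms)
qed

lemma cubic_form_real_rooted:
  fixes v :: "nat \<Rightarrow> real" and t :: complex
  assumes "cubic_form (\<lambda>i. of_real (v i) + (if i < 3 then t else 0)) = 0"
  shows "t \<in> \<real>"
proof (rule hermitian_cubic_real_rooted)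
  let ?T = "v 9 * (v 3 * v 6 + v 4 * v 7 + v 5 * v 8)
          + v 10 * (v 3 * v 8) + v 11 * (v 4 * v 6) + v 12 * (v 5 * v 7)"
  show "?T\<^sup>2 \<le> ((v 3)\<^sup>2 + (v 4)\<^sup>2 + (v 5)\<^sup>2) * ((v 6)\<^sup>2 + (v 7)\<^sup>2 + (v 8)\<^sup>2)
      * (2 * (v 9)\<^sup>2 + (v 10)\<^sup>2 + (v 11)\<^sup>2 + (v 12)\<^sup>2)"
    by (rule trilinear_bound)
  show "(of_real (v 0) + t) * (of_real (v 1) + t) * (of_real (v 2) + t)
      - of_real ((v 3)\<^sup>2 + (v 4)\<^sup>2 + (v 5)\<^sup>2) * (of_real (v 0) + t)
      - of_real ((v 6)\<^sup>2 + (v 7)\<^sup>2 + (v 8)\<^sup>2) * (of_real (v 1) + t)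
      - of_real (2 * (v 9)\<^sup>2 + (v 10)\<^sup>2 + (v 11)\<^sup>2 + (v 12)\<^sup>2) * (of_real (v 2) + t)
      + 2 * of_real ?T = 0"
    using assms by (simp add: cubic_form_def power2_eq_square mult_ac)
qed auto

text \<open>Coordinates \<open>w i \<bullet> x\<close> in which \<open>e\<close> is the point \<open>a = b = c = 1\<close>; the vectors \<open>d j\<close> realise
  prescribed values of these coordinates.\<close>

locale adapted_coordinates =
  fixes e :: "real^'n" and w d :: "nat \<Rightarrow> real^'n"
  assumes biorth: "\<And>i j. i < 13 \<Longrightarrow> j < 13 \<Longrightarrow> w i \<bullet> d j = (if i = j then 1 else 0)"
    and e_eq: "e = d 0 + d 1 + d 2"
begin

text \<open>The cubic form in the coordinates \<open>w i \<bullet> x\<close>.\<close>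

definition cubic :: "'n mpoly" where
  "cubic = cubic_form (\<lambda>i. lin_form (w i))"

lemma w_e: "i < 13 \<Longrightarrow> w i \<bullet> e = (if i < 3 then 1 else 0)"
  by (auto simp: e_eq inner_add_right biorth)

lemma eval_cubic: "mpoly_eval cubic x = cubic_form (\<lambda>i. w i \<bullet> x)"
  by (simp add: cubic_def mpoly_eval_cubic_form mpoly_eval_lin_form_real)

lemma homogeneous_cubic: "homogeneous 3 cubic"
  unfolding cubic_def by (intro homogeneous_cubic_form homogeneous_lin_form)

lemma hyperbolic_cubic: "cubic \<in> hyperbolic_polys 3 e"
  unfolding hyperbolic_polys_def
proof (intro CollectI conjI allI impI)
  show "homogeneous 3 cubic" by (rule homogeneous_cubic)
  show "mpoly_eval cubic e > 0" by (simp add: eval_cubic cubic_form_def w_e)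
  fix x :: "real^'n" and t :: complex
  assume "mpoly_eval cubic (\<chi> i. of_real (x $ i) + t * of_real (e $ i)) = 0"
  then have "cubic_form (\<lambda>i. of_real (w i \<bullet> x) + t * of_real (w i \<bullet> e)) = 0"
    by (simp add: cubic_def mpoly_eval_cubic_form mpoly_eval_lin_form_complex_line)
  then have "cubic_form (\<lambda>i. of_real (w i \<bullet> x) + (if i < 3 then t else 0)) = 0"
    by (simp add: cubic_form_def w_e)
  then show "t \<in> \<real>" by (rule cubic_form_real_rooted)
qed

lemma d0_in_cone: "d 0 \<in> hyperbolicity_cone cubic e"
  unfolding hyperbolicity_cone_def
proof (intro CollectI allI impI)
  fix t :: real
  assume "mpoly_eval cubic (t *\<^sub>R e - d 0) = 0"
  then have "(t - 1) * t * t = 0"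
    by (simp add: eval_cubic cubic_form_def inner_diff_right w_e biorth)
  then show "t \<ge> 0" by auto
qed

lemma eval_dir_deriv_d0:
  "mpoly_eval (dir_deriv (d 0) cubic) x
    = (w 1 \<bullet> x) * (w 2 \<bullet> x) - ((w 3 \<bullet> x)\<^sup>2 + (w 4 \<bullet> x)\<^sup>2 + (w 5 \<bullet> x)\<^sup>2)"
  by (rule mpoly_eval_dir_deriv_eqI)
    (auto simp: eval_cubic cubic_form_def inner_add_right biorth power2_eq_square
      intro!: derivative_eq_intros)

lemma eval_dir_deriv_e:
  "mpoly_eval (dir_deriv e cubic) x
    = (w 0 \<bullet> x) * (w 1 \<bullet> x) + (w 0 \<bullet> x) * (w 2 \<bullet> x) + (w 1 \<bullet> x) * (w 2 \<bullet> x)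
      - ((w 3 \<bullet> x)\<^sup>2 + (w 4 \<bullet> x)\<^sup>2 + (w 5 \<bullet> x)\<^sup>2)
      - ((w 6 \<bullet> x)\<^sup>2 + (w 7 \<bullet> x)\<^sup>2 + (w 8 \<bullet> x)\<^sup>2)
      - (2 * (w 9 \<bullet> x)\<^sup>2 + (w 10 \<bullet> x)\<^sup>2 + (w 11 \<bullet> x)\<^sup>2 + (w 12 \<bullet> x)\<^sup>2)"
  by (rule mpoly_eval_dir_deriv_eqI)
    (auto simp: eval_cubic cubic_form_def inner_add_right w_e power2_eq_square algebra_simps
      intro!: derivative_eq_intros)

lemma eval_dir_deriv_e_d0:
  "mpoly_eval (dir_deriv e (dir_deriv (d 0) cubic)) x = w 1 \<bullet> x + w 2 \<bullet> x"
  by (rule mpoly_eval_dir_deriv_eqI)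
    (auto simp: eval_dir_deriv_d0 inner_add_right w_e intro!: derivative_eq_intros)

section \<open>The Bezoutian in the direction of a boundary point\<close>

text \<open>Coordinates of the test points: \<open>a = b = 0\<close>, \<open>c = L\<close>, \<open>x = (X, Y, 1)\<close>, \<open>y = L \<eta>\<close> with
  \<open>\<eta> = (Y, X, X Y)\<close>, and \<open>z = ((x \<bullet> \<eta>) / 2, x\<^sub>1 \<eta>\<^sub>3, x\<^sub>2 \<eta>\<^sub>1, x\<^sub>3 \<eta>\<^sub>2)\<close>, the maximiser of
  \<open>2 T(x, \<eta>, z) - Q(z)\<close>.\<close>

definition coords :: "real \<Rightarrow> real \<Rightarrow> real \<Rightarrow> nat \<Rightarrow> real" where
  "coords X Y L i = [0, 0, L, X, Y, 1, L * Y, L * X, L * (X * Y),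
     3 / 2 * (X * Y), X\<^sup>2 * Y, Y\<^sup>2, X] ! i"

text \<open>The point of the span of the \<open>d j\<close> with these coordinates.\<close>

definition point :: "real \<Rightarrow> real \<Rightarrow> real \<Rightarrow> real^'n" where
  "point X Y L = (\<Sum>j<13. coords X Y L j *\<^sub>R d j)"

lemma w_point: "i < 13 \<Longrightarrow> w i \<bullet> point X Y L = coords X Y L i"
  by (simp add: point_def inner_sum_right biorth if_distrib cong: if_cong)

lemma bezoutian_corner_point:
  "\<exists>G. \<forall>L. mpoly_eval (bezoutian 3 cubic e (d 0) $$ (0, 0)) (point X Y L)
    = G + L\<^sup>2 * (X ^ 4 + X\<^sup>2 * Y ^ 4 + Y\<^sup>2 - 3 / 2 * X\<^sup>2 * Y\<^sup>2)"
proof (intro exI allI)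
  fix L
  show "mpoly_eval (bezoutian 3 cubic e (d 0) $$ (0, 0)) (point X Y L)
    = (X\<^sup>2 + Y\<^sup>2 + 1) * (X\<^sup>2 + Y\<^sup>2 + 1 + 9 / 2 * X\<^sup>2 * Y\<^sup>2 + X ^ 4 * Y\<^sup>2 + Y ^ 4 + X\<^sup>2)
      + L\<^sup>2 * (X ^ 4 + X\<^sup>2 * Y ^ 4 + Y\<^sup>2 - 3 / 2 * X\<^sup>2 * Y\<^sup>2)"
    by (simp add: bezoutian_corner[OF homogeneous_cubic] eval_cubic cubic_form_def
        eval_dir_deriv_d0 eval_dir_deriv_e eval_dir_deriv_e_d0 w_point coords_def)
      (simp add: field_simps power2_eq_square power4_eq_xxxx)
qed

lemma polynomial_point:
  "real_polynomial_function (\<lambda>X. mpoly_eval q (point X Y L))"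
  "real_polynomial_function (\<lambda>Y. mpoly_eval q (point X Y L))"
  "real_polynomial_function (\<lambda>L. mpoly_eval q (point X Y L))"
proof -
  have id: "real_polynomial_function (\<lambda>x::real. x)"
    by (rule real_polynomial_function.intros(1)[OF bounded_linear_ident])
  have "real_polynomial_function (\<lambda>X. coords X Y L j) \<and> real_polynomial_function (\<lambda>Y. coords X Y L j)
      \<and> real_polynomial_function (\<lambda>L. coords X Y L j)" if "j < 13" for j
  proof -
    have "j \<in> {0, 1, 2, 3, 4, 5, 6, 7, 8, 9, 10, 11, 12}" using that by (simp only: insert_iff empty_iff) presburger
    then show ?thesis
      by (auto simp: coords_def intro!: id real_polynomial_function.intros(2,4) real_polynomial_function_power)
  qed
  then show "real_polynomial_function (\<lambda>X. mpoly_eval q (point X Y L))"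
    "real_polynomial_function (\<lambda>Y. mpoly_eval q (point X Y L))"
    "real_polynomial_function (\<lambda>L. mpoly_eval q (point X Y L))"
    by (auto intro!: real_polynomial_function_mpoly_eval real_polynomial_function_sum
      real_polynomial_function.intros(2,4) simp: point_def)
qed

lemma bezoutian_not_sos: "\<not> matrix_sos (bezoutian 3 cubic e (d 0))"
proof
  let ?B = "bezoutian 3 cubic e (d 0)"
  let ?M = "\<lambda>X Y :: real. X ^ 4 + X\<^sup>2 * Y ^ 4 + Y\<^sup>2 - 3 / 2 * X\<^sup>2 * Y\<^sup>2"
  assume "matrix_sos ?B"
  moreover have dim: "?B \<in> carrier_mat 3 3"
    using bezoutian_is_bezoutian[OF homogeneous_cubic] unfolding is_bezoutian_def by blast
  ultimately obtain k Q where Q: "Q \<in> carrier_mat 3 k" "?B = Q * transpose_mat Q"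
    unfolding matrix_sos_def by auto
  define r where "r m X Y L = mpoly_eval (Q $$ (0, m)) (point X Y L)" for m X Y L
  have "?B $$ (0, 0) = (\<Sum>m<k. Q $$ (0, m) * Q $$ (0, m))"
    unfolding Q(2) using Q(1) by (simp add: scalar_prod_def lessThan_atLeast0)
  then have sos: "mpoly_eval (?B $$ (0, 0)) (point X Y L) = (\<Sum>m<k. (r m X Y L)\<^sup>2)" for X Y L
    by (simp add: r_def power2_eq_square)
  \<comment> \<open>each summand grows at most linearly in \<open>L\<close>, hence is affine in \<open>L\<close>\<close>
  have r_reflect: "r m X Y (-1) = 2 * r m X Y 0 - r m X Y 1" if m: "m < k" for m X Y
  proof -
    obtain G where G: "\<And>L. (\<Sum>m<k. (r m X Y L)\<^sup>2) = G + L\<^sup>2 * ?M X Y"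
      using bezoutian_corner_point[of X Y] unfolding sos by blast
    have "(r m X Y L)\<^sup>2 \<le> (\<bar>G\<bar> + \<bar>?M X Y\<bar>) * (1 + L\<^sup>2) ^ 1" for L
    proof -
      have "(r m X Y L)\<^sup>2 \<le> (\<Sum>m<k. (r m X Y L)\<^sup>2)"
        using m by (intro member_le_sum) auto
      also have "\<dots> \<le> \<bar>G\<bar> + L\<^sup>2 * \<bar>?M X Y\<bar>"
        unfolding G by (intro add_mono mult_left_mono abs_ge_self) simp
      also have "\<dots> \<le> (\<bar>G\<bar> + L\<^sup>2 * \<bar>?M X Y\<bar>) + (L\<^sup>2 * \<bar>G\<bar> + \<bar>?M X Y\<bar>)" by simp
      also have "\<dots> = (\<bar>G\<bar> + \<bar>?M X Y\<bar>) * (1 + L\<^sup>2) ^ 1" by (simp add: algebra_simps)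
      finally show ?thesis .
    qed
    moreover have "real_polynomial_function (r m X Y)"
      unfolding r_def[abs_def] by (rule polynomial_point)
    ultimately obtain q where "degree q \<le> 1" "r m X Y = poly q"
      using real_polynomial_function_growth by blast
    then show ?thesis by (simp add: poly_degree_le_1)
  qed
  \<comment> \<open>the slopes in \<open>L\<close>, whose squares sum to the coefficient of \<open>L\<^sup>2\<close>\<close>
  define f where "f m X Y = r m X Y 1 - r m X Y 0" for m X Y
  show False
  proof (rule motzkin_type_not_sos[of f])
    show "real_polynomial_function (\<lambda>X. f m X Y)" "real_polynomial_function (\<lambda>Y. f m X Y)" for m X Y
      unfolding f_def r_def by (intro real_polynomial_function_diff polynomial_point)+
    fix X Y
    obtain G where G: "\<And>L. (\<Sum>m<k. (r m X Y L)\<^sup>2) = G + L\<^sup>2 * ?M X Y"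
      using bezoutian_corner_point[of X Y] unfolding sos by blast
    have "(\<Sum>m<k. (r m X Y (-1))\<^sup>2) = (\<Sum>m<k. 2 * (f m X Y)\<^sup>2 + 2 * (r m X Y 0)\<^sup>2 - (r m X Y 1)\<^sup>2)"
      by (intro sum.cong refl) (simp add: r_reflect f_def power2_eq_square algebra_simps)
    then have "(\<Sum>m<k. (r m X Y (-1))\<^sup>2)
      = 2 * (\<Sum>m<k. (f m X Y)\<^sup>2) + 2 * (\<Sum>m<k. (r m X Y 0)\<^sup>2) - (\<Sum>m<k. (r m X Y 1)\<^sup>2)"
      by (simp add: sum.distrib sum_subtractf sum_distrib_left)
    then show "(\<Sum>m<k. (f m X Y)\<^sup>2) = ?M X Y"
      unfolding G by simp
  qed
qed

end

theorem corollary5p8: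
  fixes e :: "real^'n"
  assumes "CARD('n) \<ge> 43" and "e \<noteq> 0"
  shows "sos_hyperbolic_polys 3 e \<subset> hyperbolic_polys 3 e"
proof -
  have "(3 :: nat) \<le> 13" "13 \<le> CARD('n)" using assms(1) by auto
  from biorthogonal_system[OF assms(2) this] obtain w d :: "nat \<Rightarrow> real^'n" where
    "\<And>i j. i < 13 \<Longrightarrow> j < 13 \<Longrightarrow> w i \<bullet> d j = (if i = j then 1 else 0)"
    "e = d 0 + d 1 + d 2" by metis
  then interpret adapted_coordinates e w d by unfold_locales
  have "cubic \<notin> sos_hyperbolic_polys 3 e"
    using d0_in_cone bezoutian_not_sos unfolding sos_hyperbolic_polys_def by blast
  moreover have "sos_hyperbolic_polys 3 e \<subseteq> hyperbolic_polys 3 e"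
    unfolding sos_hyperbolic_polys_def by blast
  ultimately show ?thesis using hyperbolic_cubic by blast
qed

end
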